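(* Let $n\ge 2$ and let $(\mathfrak g_1,[\cdot,\cdots,\cdot]_{\mathfrak g_1},\alpha)$ and $(\mathfrak g_2,[\cdot,\cdots,\cdot]_{\mathfrak g_2},\beta)$ be two $n$-ary multiplicative Hom-Nambu-Lie superalgebras. Then $(\mathfrak g_1\oplus\mathfrak g_2,[\cdot,\cdots,\cdot]_{\mathfrak g_1\oplus\mathfrak g_2},\alpha+\beta)$ is an $n$-ary multiplicative Hom-Nambu-Lie superalgebra, where the $n$-linear map $[\cdot,\cdots,\cdot]_{\mathfrak g_1\oplus\mathfrak g_2}$ is given by $$[u_1+v_1,\cdots,u_n+v_n]_{\mathfrak g_1\oplus\mathfrak g_2}=[u_1,\cdots,u_n]_{\mathfrak g_1}+[v_1,\cdots,v_n]_{\mathfrak g_2},\qquad u_i\in\mathfrak g_1,\ v_i\in\mathfrak g_2,\ i=1,\dots,n,$$ and the linear map $\alpha+\beta:\mathfrak g_1\oplus\mathfrak g_2\to\mathfrak g_1\oplus\mathfrak g_2$ is given by $(\alpha+\beta)(u+v)=\alpha(u)+\beta(v)$ for $u\in\mathfrak g_1$, $v\in\mathfrak g_2$.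
   Context: All vector spaces are over a fixed field $\mathbb{K}$. For a $\mathbb{Z}_2$-graded vector space $\mathfrak g=\mathfrak g_{\bar 0}\oplus\mathfrak g_{\bar 1}$, $|x|\in\mathbb{Z}_2$ denotes the degree of a homogeneous element $x$; whenever $|x|$ appears, $x$ is assumed homogeneous. A linear map is even if it preserves degrees. The direct sum $\mathfrak g_1\oplus\mathfrak g_2$ is graded by $(\mathfrak g_1\oplus\mathfrak g_2)_{i}=(\mathfrak g_1)_{i}\oplus(\mathfrak g_2)_{i}$, $i\in\mathbb{Z}_2$. An $n$-ary multiplicative Hom-Nambu-Lie superalgebra is a triple $(\mathfrak g,[\cdot,\cdots,\cdot],\alpha)$ consisting of a $\mathbb{Z}_2$-graded vector space $\mathfrak g$, an $n$-linear map $[\cdot,\cdots,\cdot]:\mathfrak g\times\cdots\times\mathfrak g\to\mathfrak g$ and an even linear map $\alpha:\mathfrak g\to\mathfrak g$ such that, for all homogeneous elements: (1) $|[x_1,\cdots,x_n]|=|x_1|+\cdots+|x_n|$; (2) $[x_1,\cdots,x_i,x_{i+1},\cdots,x_n]=-(-1)^{|x_i||x_{i+1}|}[x_1,\cdots,x_{i+1},x_i,\cdots,x_n]$ for $1\le i\le n-1$; (3) $[\alpha(x_1),\cdots,\alpha(x_{n-1}),[y_1,\cdots,y_n]]=\sum_{i=1}^n(-1)^{(|x_1|+\cdots+|x_{n-1}|)(|y_1|+\cdots+|y_{i-1}|)}[\alpha(y_1),\cdots,\alpha(y_{i-1}),[x_1,\cdots,x_{n-1},y_i],\alpha(y_{i+1}),\cdots,\alpha(y_n)]$;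 (4) $\alpha[x_1,\cdots,x_n]=[\alpha(x_1),\cdots,\alpha(x_n)]$. *)

theory Defs
  imports "HOL-Analysis.Product_Vector" "HOL-Library.Z2"
begin

locale graded_vector_space = vector_space scale
  for scale :: "'k::field \<Rightarrow> 'v::ab_group_add \<Rightarrow> 'v" +
  fixes gr :: "bit \<Rightarrow> 'v set"
  assumes subspace_gr: "subspace (gr d)"
    and gr_sum: "\<exists>a\<in>gr 0. \<exists>b\<in>gr 1. x = a + b"
    and gr_inter: "gr 0 \<inter> gr 1 = {0}"

text \<open>
  The tuple \<open>xs\<close> consists of homogeneous elements with degrees \<open>ds\<close>. Degrees are
  carried separately because \<open>0\<close> is homogeneous of both degrees.
\<close>
definition homogeneous :: "(bit \<Rightarrow> 'v set) \<Rightarrow> bit list \<Rightarrow> 'v list \<Rightarrow> bool" where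
  "homogeneous gr ds xs \<longleftrightarrow> list_all2 (\<lambda>d x. x \<in> gr d) ds xs"

text \<open>\<open>(- 1) ^ d\<close> for an exponent \<open>d\<close> in the integers modulo 2.\<close>
definition parity_sign :: "bit \<Rightarrow> 'k::ring_1" where
  "parity_sign d = (if d = 0 then 1 else - 1)"

text \<open>
  An \<open>n\<close>-ary operation is a function on lists of which only the values on lists of
  length \<open>n\<close> matter. List positions start at \<open>0\<close>, so \<open>take i ys\<close> and \<open>drop (Suc i) ys\<close>
  are the entries before and after \<open>ys ! i\<close>.
\<close>
definition multilinear ::
  "nat \<Rightarrow> ('k::field \<Rightarrow> 'v::ab_group_add \<Rightarrow> 'v) \<Rightarrow> ('k \<Rightarrow> 'w::ab_group_add \<Rightarrow> 'w) \<Rightarrow> ('v list \<Rightarrow> 'w) \<Rightarrow> bool"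
where
  "multilinear n s1 s2 f \<longleftrightarrow>
     (\<forall>xs i. length xs = n \<longrightarrow> i < n \<longrightarrow> Vector_Spaces.linear s1 s2 (\<lambda>v. f (xs[i := v])))"

locale hom_nambu_lie_superalgebra = graded_vector_space scale gr
  for n :: nat
    and scale :: "'k::field \<Rightarrow> 'v::ab_group_add \<Rightarrow> 'v"
    and gr :: "bit \<Rightarrow> 'v set" +
  fixes br :: "'v list \<Rightarrow> 'v"
    and \<alpha> :: "'v \<Rightarrow> 'v"
  assumes multilinear_br: "multilinear n scale scale br"
    and linear_\<alpha>: "Vector_Spaces.linear scale scale \<alpha>"
    and even_\<alpha>: "x \<in> gr d \<Longrightarrow> \<alpha> x \<in> gr d"
    and degree_br: "\<lbrakk>length xs = n; homogeneous gr ds xs\<rbrakk> \<Longrightarrow> br xs \<in> gr (sum_list ds)"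
    and skew_br: "\<lbrakk>length xs = n; homogeneous gr ds xs; Suc i < n\<rbrakk> \<Longrightarrow>
      br xs = - scale (parity_sign (ds ! i * ds ! Suc i)) (br (xs[i := xs ! Suc i, Suc i := xs ! i]))"
    and hom_nambu_identity:
      "\<lbrakk>Suc (length xs) = n; length ys = n; homogeneous gr ds xs; homogeneous gr es ys\<rbrakk> \<Longrightarrow>
      br (map \<alpha> xs @ [br ys]) =
        (\<Sum>i<n. scale (parity_sign (sum_list ds * sum_list (take i es)))
          (br (map \<alpha> (take i ys) @ [br (xs @ [ys ! i])] @ map \<alpha> (drop (Suc i) ys))))"
    and multiplicative: "length xs = n \<Longrightarrow> \<alpha> (br xs) = br (map \<alpha> xs)"

text \<open>
  The direct sum of two vector spaces is their product type, \<open>u + v\<close> being the pair \<open>(u, v)\<close>,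
  with the componentwise scalar multiplication \<open>module_prod.scale\<close>.
\<close>
definition direct_sum_grading :: "(bit \<Rightarrow> 'v set) \<Rightarrow> (bit \<Rightarrow> 'w set) \<Rightarrow> bit \<Rightarrow> ('v \<times> 'w) set" where
  "direct_sum_grading gr1 gr2 d = gr1 d \<times> gr2 d"

definition direct_sum_bracket :: "('v list \<Rightarrow> 'v) \<Rightarrow> ('w list \<Rightarrow> 'w) \<Rightarrow> ('v \<times> 'w) list \<Rightarrow> 'v \<times> 'w" where
  "direct_sum_bracket br1 br2 ws = (br1 (map fst ws), br2 (map snd ws))"

end

theory Submission
  imports Defs
begin

text \<open>The bracket, the twist and the grading on the direct sum all act coordinatewise, so each
  axiom for pairs splits into the same axiom in each summand. The only data shared by the two
  coordinates are the signs. They depend on degrees alone, and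
  \<open>homogeneous_direct_sum_grading_iff\<close> shows that one list of degrees serves both
  projections of a homogeneous tuple, so both summands produce the same signs. The linear part rests
  on \<open>multilinear_direct_sum_bracket\<close> and \<open>linear_map_prod\<close>, the grading
  on \<open>graded_vector_space_direct_sum\<close>.\<close>

text \<open>A pair such as (u, 0) is homogeneous of the degree of u because 0 lies in both graded
  pieces. With degrees carried in \<open>ds\<close> rather than read off from elements, a zero
  coordinate needs no separate case.\<close>

lemma homogeneous_direct_sum_grading_iff:
  "homogeneous (direct_sum_grading gr1 gr2) ds ws \<longleftrightarrow>
    homogeneous gr1 ds (map fst ws) \<and> homogeneous gr2 ds (map snd ws)"
  by (auto simp: homogeneous_def direct_sum_grading_def list_all2_conv_all_nth mem_Times_iff)

context vector_space_prod
begin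

text \<open>The universal property of the product: it lets linearity of the bracket in a slot be
  checked on each coordinate.\<close>

lemma linear_Pair:
  assumes "Vector_Spaces.linear r s1 f" "Vector_Spaces.linear r s2 g"
  shows "Vector_Spaces.linear r scale (\<lambda>x. (f x, g x))"
  \<comment> \<open>\<open>Vector_Spaces.linear\<close> also asserts that source and target are
    vector spaces, so this must be supplied for the product.\<close>
  using assms p.vector_space_axioms by (simp add: Vector_Spaces.linear_iff scale_def)

lemma linear_map_prod:
  assumes "Vector_Spaces.linear s1 s1 f" "Vector_Spaces.linear s2 s2 g"
  shows "Vector_Spaces.linear scale scale (map_prod f g)"
  using assms p.vector_space_axioms by (simp add: Vector_Spaces.linear_iff scale_def map_prod_def split_beta algebra_simps)

lemma multilinear_direct_sum_bracket:
  assumes "multilinear n s1 s1 br1" "multilinear n s2 s2 br2"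
  shows "multilinear n scale scale (direct_sum_bracket br1 br2)"
  unfolding multilinear_def direct_sum_bracket_def
proof (intro allI impI linear_Pair)
  fix xs :: "('b \<times> 'c) list" and i
  assume len: "length xs = n" "i < n"
  have "Vector_Spaces.linear s1 s1 (\<lambda>v. br1 ((map fst xs)[i := v]))"
    using assms(1) len by (simp add: multilinear_def)
  \<comment> \<open>Projection commutes with updating a slot, so each coordinate is a projection
    followed by a map linear in that slot.\<close>
  from Vector_Spaces.linear_compose[OF linear_fst this]
  show "Vector_Spaces.linear scale s1 (\<lambda>v. br1 (map fst (xs[i := v])))"
    by (simp add: o_def map_update)
  have "Vector_Spaces.linear s2 s2 (\<lambda>v. br2 ((map snd xs)[i := v]))"
    using assms(2) len by (simp add: multilinear_def)
  from Vector_Spaces.linear_compose[OF linear_snd this]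
  show "Vector_Spaces.linear scale s2 (\<lambda>v. br2 (map snd (xs[i := v])))"
    by (simp add: o_def map_update)
qed

lemma graded_vector_space_direct_sum:
  assumes "graded_vector_space s1 gr1" "graded_vector_space s2 gr2"
  shows "graded_vector_space scale (direct_sum_grading gr1 gr2)"
proof -
  interpret g1: graded_vector_space s1 gr1 by fact
  interpret g2: graded_vector_space s2 gr2 by fact
  show ?thesis
  proof
    show "p.subspace (direct_sum_grading gr1 gr2 d)" for d
      unfolding direct_sum_grading_def
      by (intro subspace_Times g1.subspace_gr g2.subspace_gr)
    show "\<exists>a\<in>direct_sum_grading gr1 gr2 0. \<exists>b\<in>direct_sum_grading gr1 gr2 1. x = a + b" for x
    proof -
      obtain a b where "a \<in> gr1 0" "b \<in> gr1 1" "fst x = a + b"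
        using g1.gr_sum by blast
      moreover obtain c d where "c \<in> gr2 0" "d \<in> gr2 1" "snd x = c + d"
        using g2.gr_sum by blast
      ultimately show ?thesis
        \<comment> \<open>The even part of a pair consists of the even parts of its coordinates, and
          likewise for the odd part.\<close>
        by (intro bexI[of _ "(a, c)"] bexI[of _ "(b, d)"])
          (auto simp: direct_sum_grading_def prod_eq_iff)
    qed
    show "direct_sum_grading gr1 gr2 0 \<inter> direct_sum_grading gr1 gr2 1 = {0}"
      by (simp add: direct_sum_grading_def Times_Int_Times g1.gr_inter g2.gr_inter zero_prod_def)
  qed
qed

end

theorem proposition1p8:
  fixes n :: nat
    and s1 :: "'k::field \<Rightarrow> 'v::ab_group_add \<Rightarrow> 'v"
    and s2 :: "'k \<Rightarrow> 'w::ab_group_add \<Rightarrow> 'w"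
    and gr1 :: "bit \<Rightarrow> 'v set" and gr2 :: "bit \<Rightarrow> 'w set"
    and br1 :: "'v list \<Rightarrow> 'v" and br2 :: "'w list \<Rightarrow> 'w"
    and \<alpha> :: "'v \<Rightarrow> 'v" and \<beta> :: "'w \<Rightarrow> 'w"
  assumes "n \<ge> 2"
    and "hom_nambu_lie_superalgebra n s1 gr1 br1 \<alpha>"
    and "hom_nambu_lie_superalgebra n s2 gr2 br2 \<beta>"
  shows "hom_nambu_lie_superalgebra n (module_prod.scale s1 s2)
    (direct_sum_grading gr1 gr2) (direct_sum_bracket br1 br2) (map_prod \<alpha> \<beta>)"
proof -
  interpret A: hom_nambu_lie_superalgebra n s1 gr1 br1 \<alpha> by fact
  interpret B: hom_nambu_lie_superalgebra n s2 gr2 br2 \<beta> by fact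
  interpret vector_space_prod s1 s2 ..
  interpret graded_vector_space scale "direct_sum_grading gr1 gr2"
    by (intro graded_vector_space_direct_sum A.graded_vector_space_axioms
        B.graded_vector_space_axioms)
  \<comment> \<open>These equations move the projections inside, past the twist, to reach the form
    of the axioms of the summands. The simplifier rule \<open>map_map\<close> would instead fuse the
    two maps, so it is removed wherever they are used.\<close>
  have maps: "map fst (map (map_prod \<alpha> \<beta>) ws) = map \<alpha> (map fst ws)"
    "map snd (map (map_prod \<alpha> \<beta>) ws) = map \<beta> (map snd ws)" for ws
    by simp_all
  show ?thesis
  proof (rule hom_nambu_lie_superalgebra.intro[OF graded_vector_space_axioms],
      rule hom_nambu_lie_superalgebra_axioms.intro)
    show "multilinear n scale scale (direct_sum_bracket br1 br2)"
      by (intro multilinear_direct_sum_bracket A.multilinear_br B.multilinear_br)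
    show "Vector_Spaces.linear scale scale (map_prod \<alpha> \<beta>)"
      by (intro linear_map_prod A.linear_\<alpha> B.linear_\<alpha>)
    show "map_prod \<alpha> \<beta> x \<in> direct_sum_grading gr1 gr2 d"
      if "x \<in> direct_sum_grading gr1 gr2 d" for x d
      using that by (auto simp: direct_sum_grading_def A.even_\<alpha> B.even_\<alpha>)
    show "direct_sum_bracket br1 br2 xs \<in> direct_sum_grading gr1 gr2 (sum_list ds)"
      if "length xs = n" "homogeneous (direct_sum_grading gr1 gr2) ds xs" for xs ds
      using that A.degree_br[of "map fst xs" ds] B.degree_br[of "map snd xs" ds]
      by (simp add: homogeneous_direct_sum_grading_iff direct_sum_bracket_def
          direct_sum_grading_def)
    show "direct_sum_bracket br1 br2 xs = - scale (parity_sign (ds ! i * ds ! Suc i))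
        (direct_sum_bracket br1 br2 (xs[i := xs ! Suc i, Suc i := xs ! i]))"
      if "length xs = n" "homogeneous (direct_sum_grading gr1 gr2) ds xs" "Suc i < n" for xs ds i
      using that A.skew_br[of "map fst xs" ds i] B.skew_br[of "map snd xs" ds i]
      by (simp add: homogeneous_direct_sum_grading_iff direct_sum_bracket_def scale_def map_update)
    show "direct_sum_bracket br1 br2 (map (map_prod \<alpha> \<beta>) xs @ [direct_sum_bracket br1 br2 ys]) =
        (\<Sum>i<n. scale (parity_sign (sum_list ds * sum_list (take i es)))
          (direct_sum_bracket br1 br2 (map (map_prod \<alpha> \<beta>) (take i ys) @
            [direct_sum_bracket br1 br2 (xs @ [ys ! i])] @ map (map_prod \<alpha> \<beta>) (drop (Suc i) ys))))"
      if "Suc (length xs) = n" "length ys = n" "homogeneous (direct_sum_grading gr1 gr2) ds xs"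
        "homogeneous (direct_sum_grading gr1 gr2) es ys" for xs ys ds es
      \<comment> \<open>Projections are additive, so the sum over \<open>i\<close> splits into the
        two right-hand sides, with equal signs since \<open>ds\<close> and \<open>es\<close> are
        common to both.\<close>
      using that A.hom_nambu_identity[of "map fst xs" "map fst ys" ds es]
        B.hom_nambu_identity[of "map snd xs" "map snd ys" ds es]
      by (simp add: homogeneous_direct_sum_grading_iff direct_sum_bracket_def prod_eq_iff
          fst_sum snd_sum scale_def maps take_map drop_map del: map_map)
    show "map_prod \<alpha> \<beta> (direct_sum_bracket br1 br2 xs) =
        direct_sum_bracket br1 br2 (map (map_prod \<alpha> \<beta>) xs)"
      if "length xs = n" for xs
      using that A.multiplicative[of "map fst xs"] B.multiplicative[of "map snd xs"]
      by (simp add: direct_sum_bracket_def maps del: map_map)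
  qed
qed

end
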